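(* Let $K$ be a field, let $E=(E^0,E^1,r,s)$ be a graph, and let $(X,\{R_e\}_{e\in E^1},\{D_v\}_{v\in E^0},\{f_e\}_{e\in E^1})$ be an $E$-algebraic branching system. Let $M$ be the $K$-module of all functions $X\to K$. Then there exists a representation (that is, a $K$-algebra homomorphism) $\pi:L_K(E)\to \mathrm{Hom}_K(M)$ such that $\pi(e)=S_e$, $\pi(e^* )=S_e^*$ and $\pi(v)=P_v$ for each $e\in E^1$ and $v\in E^0$, where $S_e,S_e^*,P_v\in \mathrm{Hom}_K(M)$ are defined, for $\phi\in M$ and $x\in X$, by $$(S_e\phi)(x)=\begin{cases}\phi(f_e^{-1}(x)) & x\in R_e\\ 0 & x\notin R_e\end{cases},\qquad (S_e^*\phi)(x)=\begin{cases}\phi(f_e(x)) & x\in D_{r(e)}\\ 0 & x\notin D_{r(e)}\end{cases},\qquad (P_v\phi)(x)=\begin{cases}\phi(x) & x\in D_v\\ 0 & x\notin D_v.\end{cases}$$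
   Context: A graph $E=(E^0,E^1,r,s)$ is a directed graph with countable vertex set $E^0$, countable edge set $E^1$, and range and source maps $r,s:E^1\to E^0$. The Leavitt path algebra $L_K(E)$ is the universal $K$-algebra (not necessarily unital) generated by a set $\{v:v\in E^0\}$ of pairwise orthogonal idempotents together with elements $\{e,e^*:e\in E^1\}$ satisfying: (1) $s(e)e=er(e)=e$ for all $e\in E^1$; (2) $r(e)e^*=e^*s(e)=e^*$ for all $e\in E^1$; (3) $e^*f=\delta_{e,f}r(e)$ for all $e,f\in E^1$; (4) $v=\sum_{e\in E^1:s(e)=v}ee^*$ for every vertex $v$ with $0<\#\{e:s(e)=v\}<\infty$. An $E$-algebraic branching system consists of a set $X$, families $\{R_e\}_{e\in E^1}$, $\{D_v\}_{v\in E^0}$ of subsets of $X$, and maps $\{f_e\}_{e\in E^1}$ such that: (1) $R_e\cap R_d=\emptyset$ for $d\neq e$ in $E^1$; (2) $D_u\cap D_v=\emptyset$ for $u\ne v$ in $E^0$; (3) $R_e\subseteq D_{s(e)}$ for each $e\in E^1$; (4) $D_v=\bigcup_{e:s(e)=v}R_e$ if $0<\#\{e\in E^1:s(e)=v\}<\infty$; (5) for each $e\in E^1$, $f_e:D_{r(e)}\to R_e$ is a bijection. $\mathrm{Hom}_K(M)$ is the $K$-algebra of all $K$-linear maps $M\to M$, with composition as multiplication. *)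

theory Defs
  imports "HOL-Algebra.QuotRing" "HOL-Algebra.Module" "HOL-Library.Countable_Set" "Graph_Theory.Digraph"
begin

text \<open>
  A graph is a \<^const>\<open>wf_digraph\<close>, with source map \<^const>\<open>tail\<close> and range map \<^const>\<open>head\<close>.
  K-algebras are associative but not necessarily unital.  They are represented by the
  \<^typ>\<open>('k, 'a) module\<close> record, whose field \<^const>\<open>one\<close> carries no information (and is
  left \<^term>\<open>undefined\<close>) when the algebra has no designated unit.
\<close>

definition algebra_hom ::
    "('k, 'm) ring_scheme \<Rightarrow> ('k, 'a, 'p) module_scheme \<Rightarrow> ('k, 'b, 'q) module_scheme
      \<Rightarrow> ('a \<Rightarrow> 'b) set" where
  "algebra_hom K A B =
    {h \<in> hom (add_monoid A) (add_monoid B) \<inter> hom A B.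
      \<forall>k\<in>carrier K. \<forall>a\<in>carrier A. h (k \<odot>\<^bsub>A\<^esub> a) = k \<odot>\<^bsub>B\<^esub> h a}"

definition algebra_ideal ::
    "('k, 'm) ring_scheme \<Rightarrow> ('k, 'a, 'p) module_scheme \<Rightarrow> 'a set \<Rightarrow> bool" where
  "algebra_ideal K A I \<longleftrightarrow>
    additive_subgroup I A \<and>
    (\<forall>i\<in>I. \<forall>a\<in>carrier A. a \<otimes>\<^bsub>A\<^esub> i \<in> I \<and> i \<otimes>\<^bsub>A\<^esub> a \<in> I) \<and>
    (\<forall>i\<in>I. \<forall>k\<in>carrier K. k \<odot>\<^bsub>A\<^esub> i \<in> I)"

text \<open>
  \<^const>\<open>genideal\<close> is not applicable here: \<^const>\<open>ideal\<close> requires the ambient ring to be unital.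
\<close>

definition generated_ideal ::
    "('k, 'm) ring_scheme \<Rightarrow> ('k, 'a, 'p) module_scheme \<Rightarrow> 'a set \<Rightarrow> 'a set" where
  "generated_ideal K A S = \<Inter>{I. algebra_ideal K A I \<and> S \<subseteq> I}"

text \<open>As \<^const>\<open>FactRing\<close>, with the induced scalar multiplication and without unit.\<close>

definition quotient_algebra ::
    "('k, 'a, 'p) module_scheme \<Rightarrow> 'a set \<Rightarrow> ('k, 'a set) module" where
  "quotient_algebra A I =
    \<lparr>carrier = a_rcosets\<^bsub>A\<^esub> I,
     monoid.mult = rcoset_mult A I,
     one = undefined,
     zero = I,
     add = set_add A,
     smult = (\<lambda>k U. \<Union>a\<in>U. I +>\<^bsub>A\<^esub> (k \<odot>\<^bsub>A\<^esub> a))\<rparr>"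

text \<open>
  The free non-unital K-algebra on a set \<open>G\<close>: finitely supported K-valued functions on the
  \<^emph>\<open>nonempty\<close> words over \<open>G\<close>.  The product extends concatenation of words bilinearly, so its
  coefficient at \<open>w\<close> is a sum over all ways of cutting \<open>w\<close> in two; cuts with an empty part
  contribute zero.
\<close>

definition free_algebra :: "('k, 'm) ring_scheme \<Rightarrow> 'g set \<Rightarrow> ('k, 'g list \<Rightarrow> 'k) module" where
  "free_algebra K G =
    \<lparr>carrier = {a. (\<forall>w. a w \<in> carrier K) \<and> finite {w. a w \<noteq> \<zero>\<^bsub>K\<^esub>} \<and>
                   {w. a w \<noteq> \<zero>\<^bsub>K\<^esub>} \<subseteq> lists G - {[]}},
     monoid.mult = (\<lambda>a b w. \<Oplus>\<^bsub>K\<^esub>i\<in>{..length w}. a (take i w) \<otimes>\<^bsub>K\<^esub> b (drop i w)),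
     one = undefined,
     zero = (\<lambda>w. \<zero>\<^bsub>K\<^esub>),
     add = (\<lambda>a b w. a w \<oplus>\<^bsub>K\<^esub> b w),
     smult = (\<lambda>k a w. k \<otimes>\<^bsub>K\<^esub> a w)\<rparr>"

definition free_gen :: "('k, 'm) ring_scheme \<Rightarrow> 'g \<Rightarrow> 'g list \<Rightarrow> 'k" where
  "free_gen K g = (\<lambda>w. if w = [g] then \<one>\<^bsub>K\<^esub> else \<zero>\<^bsub>K\<^esub>)"

text \<open>\<open>Ghost e\<close> stands for the generator \<open>e\<close>-star.\<close>

datatype ('v, 'e) lpa_gen = Vert 'v | Edge 'e | Ghost 'e

definition lpa_gens :: "('v, 'e) pre_digraph \<Rightarrow> ('v, 'e) lpa_gen set" where
  "lpa_gens E = Vert ` verts E \<union> Edge ` arcs E \<union> Ghost ` arcs E"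

abbreviation lpa_free ::
    "('k, 'm) ring_scheme \<Rightarrow> ('v, 'e) pre_digraph \<Rightarrow> ('k, ('v, 'e) lpa_gen list \<Rightarrow> 'k) module"
  where "lpa_free K E \<equiv> free_algebra K (lpa_gens E)"

text \<open>A defining relation \<open>a = b\<close> is encoded by the relator \<open>a - b\<close>.\<close>

inductive_set lpa_relators ::
    "('k, 'm) ring_scheme \<Rightarrow> ('v, 'e) pre_digraph \<Rightarrow> (('v, 'e) lpa_gen list \<Rightarrow> 'k) set"
  for K :: "('k, 'm) ring_scheme" and E :: "('v, 'e) pre_digraph"
where
  vertex_idem: "v \<in> verts E \<Longrightarrow>
    free_gen K (Vert v) \<otimes>\<^bsub>lpa_free K E\<^esub> free_gen K (Vert v)
      \<ominus>\<^bsub>lpa_free K E\<^esub> free_gen K (Vert v) \<in> lpa_relators K E"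
| vertex_orth: "\<lbrakk>u \<in> verts E; v \<in> verts E; u \<noteq> v\<rbrakk> \<Longrightarrow>
    free_gen K (Vert u) \<otimes>\<^bsub>lpa_free K E\<^esub> free_gen K (Vert v) \<in> lpa_relators K E"
| source_edge: "e \<in> arcs E \<Longrightarrow>
    free_gen K (Vert (tail E e)) \<otimes>\<^bsub>lpa_free K E\<^esub> free_gen K (Edge e)
      \<ominus>\<^bsub>lpa_free K E\<^esub> free_gen K (Edge e) \<in> lpa_relators K E"
| edge_range: "e \<in> arcs E \<Longrightarrow>
    free_gen K (Edge e) \<otimes>\<^bsub>lpa_free K E\<^esub> free_gen K (Vert (head E e))
      \<ominus>\<^bsub>lpa_free K E\<^esub> free_gen K (Edge e) \<in> lpa_relators K E"
| range_ghost: "e \<in> arcs E \<Longrightarrow>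
    free_gen K (Vert (head E e)) \<otimes>\<^bsub>lpa_free K E\<^esub> free_gen K (Ghost e)
      \<ominus>\<^bsub>lpa_free K E\<^esub> free_gen K (Ghost e) \<in> lpa_relators K E"
| ghost_source: "e \<in> arcs E \<Longrightarrow>
    free_gen K (Ghost e) \<otimes>\<^bsub>lpa_free K E\<^esub> free_gen K (Vert (tail E e))
      \<ominus>\<^bsub>lpa_free K E\<^esub> free_gen K (Ghost e) \<in> lpa_relators K E"
| ghost_edge_same: "e \<in> arcs E \<Longrightarrow>
    free_gen K (Ghost e) \<otimes>\<^bsub>lpa_free K E\<^esub> free_gen K (Edge e)
      \<ominus>\<^bsub>lpa_free K E\<^esub> free_gen K (Vert (head E e)) \<in> lpa_relators K E"
| ghost_edge_diff: "\<lbrakk>e \<in> arcs E; f \<in> arcs E; e \<noteq> f\<rbrakk> \<Longrightarrow>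
    free_gen K (Ghost e) \<otimes>\<^bsub>lpa_free K E\<^esub> free_gen K (Edge f) \<in> lpa_relators K E"
| vertex_sum: "\<lbrakk>v \<in> verts E; out_arcs E v \<noteq> {}; finite (out_arcs E v)\<rbrakk> \<Longrightarrow>
    free_gen K (Vert v) \<ominus>\<^bsub>lpa_free K E\<^esub>
      (\<Oplus>\<^bsub>lpa_free K E\<^esub>e\<in>out_arcs E v.
        free_gen K (Edge e) \<otimes>\<^bsub>lpa_free K E\<^esub> free_gen K (Ghost e)) \<in> lpa_relators K E"

definition lpa_ideal ::
    "('k, 'm) ring_scheme \<Rightarrow> ('v, 'e) pre_digraph \<Rightarrow> (('v, 'e) lpa_gen list \<Rightarrow> 'k) set" where
  "lpa_ideal K E = generated_ideal K (lpa_free K E) (lpa_relators K E)"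

definition leavitt_path_algebra ::
    "('k, 'm) ring_scheme \<Rightarrow> ('v, 'e) pre_digraph
      \<Rightarrow> ('k, (('v, 'e) lpa_gen list \<Rightarrow> 'k) set) module" where
  "leavitt_path_algebra K E = quotient_algebra (lpa_free K E) (lpa_ideal K E)"

definition lpa_elem ::
    "('k, 'm) ring_scheme \<Rightarrow> ('v, 'e) pre_digraph \<Rightarrow> ('v, 'e) lpa_gen
      \<Rightarrow> (('v, 'e) lpa_gen list \<Rightarrow> 'k) set" where
  "lpa_elem K E g = lpa_ideal K E +>\<^bsub>lpa_free K E\<^esub> free_gen K g"

text \<open>Only the values of \<open>R\<close> and \<open>f\<close> on edges and of \<open>D\<close> on vertices are relevant.\<close>

locale branching_system =
  fixes E :: "('v, 'e) pre_digraph"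
    and X :: "'x set"
    and R :: "'e \<Rightarrow> 'x set"
    and D :: "'v \<Rightarrow> 'x set"
    and f :: "'e \<Rightarrow> 'x \<Rightarrow> 'x"
  assumes R_subset: "e \<in> arcs E \<Longrightarrow> R e \<subseteq> X"
    and D_subset: "v \<in> verts E \<Longrightarrow> D v \<subseteq> X"
    and R_disjoint: "\<lbrakk>d \<in> arcs E; e \<in> arcs E; d \<noteq> e\<rbrakk> \<Longrightarrow> R e \<inter> R d = {}"
    and D_disjoint: "\<lbrakk>u \<in> verts E; v \<in> verts E; u \<noteq> v\<rbrakk> \<Longrightarrow> D u \<inter> D v = {}"
    and R_subset_D: "e \<in> arcs E \<Longrightarrow> R e \<subseteq> D (tail E e)"
    and D_eq_Union: "\<lbrakk>v \<in> verts E; out_arcs E v \<noteq> {}; finite (out_arcs E v)\<rbrakk>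
      \<Longrightarrow> D v = (\<Union>e\<in>out_arcs E v. R e)"
    and f_bij: "e \<in> arcs E \<Longrightarrow> bij_betw (f e) (D (head E e)) (R e)"

text \<open>
  Functions on \<open>X\<close> are extensional, so that the carrier is exactly the set of maps from \<open>X\<close>
  to K; likewise for the linear maps in \<open>Hom_alg\<close>.  Only the module structure of
  \<open>fun_module\<close> is meaningful.
\<close>

definition fun_module :: "('k, 'm) ring_scheme \<Rightarrow> 'x set \<Rightarrow> ('k, 'x \<Rightarrow> 'k) module" where
  "fun_module K X =
    \<lparr>carrier = X \<rightarrow>\<^sub>E carrier K,
     monoid.mult = undefined,
     one = undefined,
     zero = (\<lambda>x\<in>X. \<zero>\<^bsub>K\<^esub>),
     add = (\<lambda>\<phi> \<psi>. \<lambda>x\<in>X. \<phi> x \<oplus>\<^bsub>K\<^esub> \<psi> x),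
     smult = (\<lambda>k \<phi>. \<lambda>x\<in>X. k \<otimes>\<^bsub>K\<^esub> \<phi> x)\<rparr>"

definition Hom_alg ::
    "('k, 'm) ring_scheme \<Rightarrow> ('k, 'a, 'p) module_scheme \<Rightarrow> ('k, 'a \<Rightarrow> 'a) module" where
  "Hom_alg K M =
    \<lparr>carrier = {T \<in> carrier M \<rightarrow>\<^sub>E carrier M.
        (\<forall>\<phi>\<in>carrier M. \<forall>\<psi>\<in>carrier M. T (\<phi> \<oplus>\<^bsub>M\<^esub> \<psi>) = T \<phi> \<oplus>\<^bsub>M\<^esub> T \<psi>) \<and>
        (\<forall>k\<in>carrier K. \<forall>\<phi>\<in>carrier M. T (k \<odot>\<^bsub>M\<^esub> \<phi>) = k \<odot>\<^bsub>M\<^esub> T \<phi>)},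
     monoid.mult = (\<lambda>S T. \<lambda>\<phi>\<in>carrier M. S (T \<phi>)),
     one = (\<lambda>\<phi>\<in>carrier M. \<phi>),
     zero = (\<lambda>\<phi>\<in>carrier M. \<zero>\<^bsub>M\<^esub>),
     add = (\<lambda>S T. \<lambda>\<phi>\<in>carrier M. S \<phi> \<oplus>\<^bsub>M\<^esub> T \<phi>),
     smult = (\<lambda>k T. \<lambda>\<phi>\<in>carrier M. k \<odot>\<^bsub>M\<^esub> T \<phi>)\<rparr>"

definition S_op ::
    "('k, 'm) ring_scheme \<Rightarrow> ('v, 'e) pre_digraph \<Rightarrow> 'x set \<Rightarrow> ('e \<Rightarrow> 'x set) \<Rightarrow> ('v \<Rightarrow> 'x set)
      \<Rightarrow> ('e \<Rightarrow> 'x \<Rightarrow> 'x) \<Rightarrow> 'e \<Rightarrow> ('x \<Rightarrow> 'k) \<Rightarrow> ('x \<Rightarrow> 'k)" where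
  "S_op K E X R D f e = (\<lambda>\<phi>\<in>carrier (fun_module K X). \<lambda>x\<in>X.
     if x \<in> R e then \<phi> (inv_into (D (head E e)) (f e) x) else \<zero>\<^bsub>K\<^esub>)"

definition S_star_op ::
    "('k, 'm) ring_scheme \<Rightarrow> ('v, 'e) pre_digraph \<Rightarrow> 'x set \<Rightarrow> ('v \<Rightarrow> 'x set)
      \<Rightarrow> ('e \<Rightarrow> 'x \<Rightarrow> 'x) \<Rightarrow> 'e \<Rightarrow> ('x \<Rightarrow> 'k) \<Rightarrow> ('x \<Rightarrow> 'k)" where
  "S_star_op K E X D f e = (\<lambda>\<phi>\<in>carrier (fun_module K X). \<lambda>x\<in>X.
     if x \<in> D (head E e) then \<phi> (f e x) else \<zero>\<^bsub>K\<^esub>)"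

definition P_op ::
    "('k, 'm) ring_scheme \<Rightarrow> 'x set \<Rightarrow> ('v \<Rightarrow> 'x set) \<Rightarrow> 'v \<Rightarrow> ('x \<Rightarrow> 'k) \<Rightarrow> ('x \<Rightarrow> 'k)" where
  "P_op K X D v = (\<lambda>\<phi>\<in>carrier (fun_module K X). \<lambda>x\<in>X.
     if x \<in> D v then \<phi> x else \<zero>\<^bsub>K\<^esub>)"

end

theory Submission
  imports Defs
begin

text \<open>
  A word acts on functions by composing the operators of its letters, and linear extension gives a
  homomorphism from the free algebra to the linear maps.  For the operators of a branching system,
  it kills the defining relators, hence factors through the quotient.
\<close>

text \<open>Two obstacles shape the argument. The free algebra has no unit, so kernels and quotients
  are handled in a weak setting, \<open>distrib_algebra\<close>, which the linear maps share; a
  homomorphism out of the quotient is then read off from the values of \<open>eval\<close> on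
  cosets. Moreover, the product of the free algebra is a convolution over the cuts of a word,
  whereas a composition of two evaluations is a sum over pairs of words. Multiplicativity of
  \<open>eval\<close> is therefore a re-indexing of finite sums, made delicate by the fact that
  several pairs of words can have the same concatenation. On the geometric side,
  \<open>S_e S_e^*\<close> is multiplication by the indicator function of \<open>R e\<close>, and
  \<open>P_v\<close> by that of \<open>D v\<close>. The summation relation at a vertex thus says
  that the indicator of \<open>D v\<close> is the sum of the indicators of the disjoint sets
  \<open>R e\<close>.\<close>

lemma (in comm_monoid) finprod_Sigma:
  assumes "finite A" "\<And>x. x \<in> A \<Longrightarrow> finite (B x)" "g \<in> Sigma A B \<rightarrow> carrier G"
  shows "finprod G (\<lambda>x. finprod G (\<lambda>y. g (x, y)) (B x)) A = finprod G g (Sigma A B)"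
  using assms
proof (induction A rule: finite_induct)
  case empty
  then show ?case by simp
next
  case (insert x A)
  have "finprod G g (Sigma (insert x A) B) = finprod G g (Pair x ` B x \<union> Sigma A B)"
    by (rule arg_cong[where f = "finprod G g"]) auto
  also have "\<dots> = finprod G g (Pair x ` B x) \<otimes> finprod G g (Sigma A B)"
    using insert by (intro finprod_Un_disjoint) auto
  also have "finprod G g (Pair x ` B x) = finprod G (\<lambda>y. g (x, y)) (B x)"
    using insert.prems by (intro finprod_reindex) (auto simp: inj_on_def)
  also have "finprod G g (Sigma A B) = finprod G (\<lambda>x. finprod G (\<lambda>y. g (x, y)) (B x)) A"
    using insert by (intro insert.IH[symmetric]) auto
  also have "finprod G (\<lambda>y. g (x, y)) (B x) \<otimes> finprod G (\<lambda>x. finprod G (\<lambda>y. g (x, y)) (B x)) A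
      = finprod G (\<lambda>x. finprod G (\<lambda>y. g (x, y)) (B x)) (insert x A)"
    using insert by (intro finprod_insert[symmetric]) (auto intro!: finprod_closed)
  finally show ?case by simp
qed

text \<open>Serves \<open>eval_mult\<close> in both directions: it flattens a sum over words and
  their cut positions, and splits a sum over a product of two supports.\<close>

lemma (in abelian_monoid) finsum_Sigma:
  assumes "finite A" "\<And>x. x \<in> A \<Longrightarrow> finite (B x)" "g \<in> Sigma A B \<rightarrow> carrier G"
  shows "finsum G (\<lambda>x. \<Oplus>\<^bsub>G\<^esub>y\<in>B x. g (x, y)) A = finsum G g (Sigma A B)"
  using comm_monoid.finprod_Sigma[OF a_comm_monoid, of A B g] assms by (simp add: finsum_def)

text \<open>Stated for bare additive homomorphisms so that it covers a linear map, the map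
  \<open>eval\<close>, and evaluation of an operator at a fixed function and point.\<close>

lemma (in abelian_group) hom_finsum_group:
  assumes "abelian_group H" "h \<in> hom (add_monoid G) (add_monoid H)"
    and "finite A" "g \<in> A \<rightarrow> carrier G"
  shows "h (finsum G g A) = finsum H (\<lambda>x. h (g x)) A"
  using assms(3,4)
proof (induction A rule: finite_induct)
  case empty
  interpret H: abelian_group H by fact
  interpret h: group_hom "add_monoid G" "add_monoid H" h
    using assms by (simp add: group_hom_def group_hom_axioms_def a_group H.a_group)
  show ?case using h.hom_one by simp
next
  case (insert x A)
  interpret H: abelian_group H by fact
  have *: "h y \<in> carrier H" if "y \<in> carrier G" for y
    using assms(2) that by (auto simp: hom_def)
  show ?case
    using insert assms(2) by (simp add: Pi_def * hom_def)
qed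

lemma (in abelian_group) hom_a_minus:
  assumes "abelian_group H" "h \<in> hom (add_monoid G) (add_monoid H)"
    and "x \<in> carrier G" "y \<in> carrier G"
  shows "h (x \<ominus> y) = h x \<ominus>\<^bsub>H\<^esub> h y"
proof -
  interpret H: abelian_group H by fact
  interpret h: group_hom "add_monoid G" "add_monoid H" h
    using assms by (simp add: group_hom_def group_hom_axioms_def a_group H.a_group)
  have "h (\<ominus> y) = \<ominus>\<^bsub>H\<^esub> h y"
    using h.hom_inv[of y] assms by (simp add: a_inv_def)
  then show ?thesis
    using h.hom_mult[of x "\<ominus> y"] assms by (simp add: a_minus_def)
qed

lemma (in Module.module) finsum_smult_rdistr:
  assumes "finite A" "g \<in> A \<rightarrow> carrier R" "x \<in> carrier M"
  shows "(\<Oplus>\<^bsub>R\<^esub>i\<in>A. g i) \<odot>\<^bsub>M\<^esub> x = (\<Oplus>\<^bsub>M\<^esub>i\<in>A. g i \<odot>\<^bsub>M\<^esub> x)"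
  using assms by (induction A rule: finite_induct) (auto simp: Pi_def smult_l_distr)

section \<open>Algebras without unit and their quotients\<close>

text \<open>Common ground of the free algebra and the linear maps. Additivity of the product in each
  factor and of scaling in its vector argument forces products with zero and scalar multiples of
  zero to vanish, which makes kernels absorbing.\<close>

locale distrib_algebra = abelian_group A
  for K :: "('k, 'm) ring_scheme" and A :: "('k, 'a, 'p) module_scheme" (structure) +
  assumes mult_closed: "\<lbrakk>a \<in> carrier A; b \<in> carrier A\<rbrakk> \<Longrightarrow> a \<otimes> b \<in> carrier A"
    and smult_closed: "\<lbrakk>k \<in> carrier K; a \<in> carrier A\<rbrakk> \<Longrightarrow> k \<odot> a \<in> carrier A"
    and l_distr: "\<lbrakk>a \<in> carrier A; b \<in> carrier A; c \<in> carrier A\<rbrakk>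
      \<Longrightarrow> (a \<oplus> b) \<otimes> c = a \<otimes> c \<oplus> b \<otimes> c"
    and r_distr: "\<lbrakk>a \<in> carrier A; b \<in> carrier A; c \<in> carrier A\<rbrakk>
      \<Longrightarrow> a \<otimes> (b \<oplus> c) = a \<otimes> b \<oplus> a \<otimes> c"
    and smult_distr: "\<lbrakk>k \<in> carrier K; a \<in> carrier A; b \<in> carrier A\<rbrakk>
      \<Longrightarrow> k \<odot> (a \<oplus> b) = k \<odot> a \<oplus> k \<odot> b"
begin

lemma mult_zero_left: "a \<in> carrier A \<Longrightarrow> \<zero> \<otimes> a = \<zero>"
  using l_distr[of \<zero> \<zero> a] mult_closed[of \<zero> a] by (simp add: add.r_cancel_one')

lemma mult_zero_right: "a \<in> carrier A \<Longrightarrow> a \<otimes> \<zero> = \<zero>"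
  using r_distr[of a \<zero> \<zero>] mult_closed[of a \<zero>] by (simp add: add.r_cancel_one')

lemma smult_zero_right: "k \<in> carrier K \<Longrightarrow> k \<odot> \<zero> = \<zero>"
  using smult_distr[of k \<zero> \<zero>] smult_closed[of k \<zero>] by (simp add: add.r_cancel_one')

end

lemma a_kernel_eq: "a_kernel A B h = {a \<in> carrier A. h a = \<zero>\<^bsub>B\<^esub>}"
  by (simp add: a_kernel_def kernel_def)

text \<open>Absorption holds because the image of a product with a kernel element has a zero factor
  in \<open>B\<close>, on whichever side.\<close>

lemma algebra_ideal_kernel:
  assumes "distrib_algebra K A" "distrib_algebra K B" "h \<in> algebra_hom K A B"
  shows "algebra_ideal K A (a_kernel A B h)"
proof -
  interpret A: distrib_algebra K A by fact
  interpret B: distrib_algebra K B by fact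
  interpret h: group_hom "add_monoid A" "add_monoid B" h
    using assms(3)
    by (simp add: group_hom_def group_hom_axioms_def A.a_group B.a_group algebra_hom_def)
  have "additive_subgroup (a_kernel A B h) A"
    using h.subgroup_kernel by (simp add: additive_subgroup_def a_kernel_def)
  moreover have "h a \<in> carrier B" if "a \<in> carrier A" for a
    using h.hom_closed that by simp
  ultimately show ?thesis
    using assms(3)
    by (auto simp: algebra_ideal_def a_kernel_eq algebra_hom_def hom_def A.mult_closed A.smult_closed
        B.mult_zero_left B.mult_zero_right B.smult_zero_right)
qed

text \<open>Applied to a kernel, this reduces vanishing on the whole ideal to vanishing on the
  relators.\<close>

lemma generated_ideal_minimal:
  "\<lbrakk>algebra_ideal K A I; S \<subseteq> I\<rbrakk> \<Longrightarrow> generated_ideal K A S \<subseteq> I"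
  by (auto simp: generated_ideal_def)

text \<open>Needed so that every coset contains its own representative and is in particular
  nonempty.\<close>

lemma zero_in_generated_ideal: "\<zero>\<^bsub>A\<^esub> \<in> generated_ideal K A S"
  by (auto simp: generated_ideal_def algebra_ideal_def additive_subgroup.zero_closed)

text \<open>As \<open>I\<close> lies in the kernel, \<open>h\<close> is constant on each coset, and
  as \<open>I\<close> contains zero, the constant is the value at the representative. The operations
  of the quotient are concrete sets of elements of \<open>A\<close>, and \<open>h\<close> is
  constant on those sets too, with the value dictated by the homomorphism laws.\<close>

lemma quotient_algebra_hom:
  assumes "distrib_algebra K A" "distrib_algebra K B" and h: "h \<in> algebra_hom K A B"
    and I0: "\<zero>\<^bsub>A\<^esub> \<in> I" and Ik: "I \<subseteq> a_kernel A B h"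
  shows "\<exists>\<pi>\<in>algebra_hom K (quotient_algebra A I) B. \<forall>a\<in>carrier A. \<pi> (I +>\<^bsub>A\<^esub> a) = h a"
proof -
  interpret A: distrib_algebra K A by fact
  interpret B: distrib_algebra K B by fact
  have h_closed: "h a \<in> carrier B" if "a \<in> carrier A" for a
    using h that by (auto simp: algebra_hom_def hom_def)
  have h_add: "h (a \<oplus>\<^bsub>A\<^esub> b) = h a \<oplus>\<^bsub>B\<^esub> h b" if "a \<in> carrier A" "b \<in> carrier A" for a b
    using h that by (auto simp: algebra_hom_def hom_def)
  have h_mult: "h (a \<otimes>\<^bsub>A\<^esub> b) = h a \<otimes>\<^bsub>B\<^esub> h b" if "a \<in> carrier A" "b \<in> carrier A" for a b
    using h that by (auto simp: algebra_hom_def hom_def)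
  have h_smult: "h (k \<odot>\<^bsub>A\<^esub> a) = k \<odot>\<^bsub>B\<^esub> h a" if "k \<in> carrier K" "a \<in> carrier A" for k a
    using h that by (auto simp: algebra_hom_def)
  define \<pi> where "\<pi> U = the_elem (h ` U)" for U
  \<comment> \<open>All laws for \<pi> take this route: the set in question is nonempty and
    \<open>h\<close> takes one value on it.\<close>
  have \<pi>_eqI: "\<pi> U = c" if "U \<noteq> {}" "\<And>a. a \<in> U \<Longrightarrow> h a = c" for U c
  proof -
    have "h ` U = {c}" using that by auto
    then show ?thesis by (simp add: \<pi>_def)
  qed
  have coset: "b \<in> carrier A \<and> h b = h a" if "a \<in> carrier A" "b \<in> I +>\<^bsub>A\<^esub> a" for a b
    using that Ik h_closed by (auto simp: a_r_coset_def' a_kernel_eq h_add subset_iff)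
  have self: "a \<in> I +>\<^bsub>A\<^esub> a" if "a \<in> carrier A" for a
    using that I0 by (force simp: a_r_coset_def')
  have \<pi>_coset: "\<pi> (I +>\<^bsub>A\<^esub> a) = h a" if "a \<in> carrier A" for a
    using that coset self by (intro \<pi>_eqI) blast+
  have \<pi>_add: "\<pi> (U \<oplus>\<^bsub>quotient_algebra A I\<^esub> V) = \<pi> U \<oplus>\<^bsub>B\<^esub> \<pi> V"
    and \<pi>_mult: "\<pi> (U \<otimes>\<^bsub>quotient_algebra A I\<^esub> V) = \<pi> U \<otimes>\<^bsub>B\<^esub> \<pi> V"
    if UV: "U \<in> a_rcosets\<^bsub>A\<^esub> I" "V \<in> a_rcosets\<^bsub>A\<^esub> I" for U V
  proof -
    obtain a b where a: "a \<in> carrier A" "U = I +>\<^bsub>A\<^esub> a" and b: "b \<in> carrier A" "V = I +>\<^bsub>A\<^esub> b"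
      using UV by (auto simp: A_RCOSETS_def')
    note U = coset[OF a(1), folded a(2)] and V = coset[OF b(1), folded b(2)]
    have ab: "a \<in> U" "b \<in> V" using self a b by auto
    have \<pi>UV: "\<pi> U = h a" "\<pi> V = h b" using \<pi>_coset a b by auto
    show "\<pi> (U \<oplus>\<^bsub>quotient_algebra A I\<^esub> V) = \<pi> U \<oplus>\<^bsub>B\<^esub> \<pi> V"
    proof (rule \<pi>_eqI)
      show "U \<oplus>\<^bsub>quotient_algebra A I\<^esub> V \<noteq> {}"
        using ab by (auto simp: quotient_algebra_def set_add_def')
      fix c assume "c \<in> U \<oplus>\<^bsub>quotient_algebra A I\<^esub> V"
      then obtain u v where "u \<in> U" "v \<in> V" "c = u \<oplus>\<^bsub>A\<^esub> v"
        by (auto simp: quotient_algebra_def set_add_def')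
      then show "h c = \<pi> U \<oplus>\<^bsub>B\<^esub> \<pi> V"
        using U V by (simp add: h_add \<pi>UV)
    qed
    \<comment> \<open>Unlike the sum, the product of cosets is a union of the cosets of all u
      \<otimes> v, so \<open>coset\<close> is used at two levels: for the factors u and v, and for c
      inside the coset of u \<otimes> v.\<close>
    show "\<pi> (U \<otimes>\<^bsub>quotient_algebra A I\<^esub> V) = \<pi> U \<otimes>\<^bsub>B\<^esub> \<pi> V"
    proof (rule \<pi>_eqI)
      show "U \<otimes>\<^bsub>quotient_algebra A I\<^esub> V \<noteq> {}"
        using ab self[OF A.mult_closed[OF a(1) b(1)]]
        by (auto simp: quotient_algebra_def rcoset_mult_def)
      fix c assume "c \<in> U \<otimes>\<^bsub>quotient_algebra A I\<^esub> V"
      then obtain u v where "u \<in> U" "v \<in> V" "c \<in> I +>\<^bsub>A\<^esub> (u \<otimes>\<^bsub>A\<^esub> v)"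
        by (auto simp: quotient_algebra_def rcoset_mult_def)
      then show "h c = \<pi> U \<otimes>\<^bsub>B\<^esub> \<pi> V"
        using U[of u] V[of v] coset[of "u \<otimes>\<^bsub>A\<^esub> v" c] by (simp add: A.mult_closed h_mult \<pi>UV)
    qed
  qed
  have \<pi>_smult: "\<pi> (k \<odot>\<^bsub>quotient_algebra A I\<^esub> U) = k \<odot>\<^bsub>B\<^esub> \<pi> U"
    if k: "k \<in> carrier K" and U: "U \<in> a_rcosets\<^bsub>A\<^esub> I" for k U
  proof -
    obtain a where a: "a \<in> carrier A" "U = I +>\<^bsub>A\<^esub> a"
      using U by (auto simp: A_RCOSETS_def')
    show ?thesis
    proof (rule \<pi>_eqI)
      show "k \<odot>\<^bsub>quotient_algebra A I\<^esub> U \<noteq> {}"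
        using a self[OF a(1)] self[OF A.smult_closed[OF k a(1)]]
        by (auto simp: quotient_algebra_def)
      fix c assume "c \<in> k \<odot>\<^bsub>quotient_algebra A I\<^esub> U"
      then obtain u where "u \<in> U" "c \<in> I +>\<^bsub>A\<^esub> (k \<odot>\<^bsub>A\<^esub> u)"
        by (auto simp: quotient_algebra_def)
      then show "h c = k \<odot>\<^bsub>B\<^esub> \<pi> U"
        using coset[OF a(1), folded a(2), of u] coset[of "k \<odot>\<^bsub>A\<^esub> u" c] \<pi>_coset[OF a(1), folded a(2)] k
        by (simp add: A.smult_closed h_smult)
    qed
  qed
  have carr: "carrier (quotient_algebra A I) = a_rcosets\<^bsub>A\<^esub> I"
    by (simp add: quotient_algebra_def)
  have "\<pi> U \<in> carrier B" if "U \<in> a_rcosets\<^bsub>A\<^esub> I" for U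
    using that \<pi>_coset h_closed by (auto simp: A_RCOSETS_def')
  then have "\<pi> \<in> algebra_hom K (quotient_algebra A I) B"
    using \<pi>_add \<pi>_mult \<pi>_smult by (auto simp: algebra_hom_def hom_def carr)
  then show ?thesis using \<pi>_coset by auto
qed

section \<open>The free algebra\<close>

lemma free_algebra_mult_apply:
  "(a \<otimes>\<^bsub>free_algebra K G\<^esub> b) w = (\<Oplus>\<^bsub>K\<^esub>i\<in>{..length w}. a (take i w) \<otimes>\<^bsub>K\<^esub> b (drop i w))"
  by (simp add: free_algebra_def)

lemma free_algebra_simps:
  "a \<oplus>\<^bsub>free_algebra K G\<^esub> b = (\<lambda>w. a w \<oplus>\<^bsub>K\<^esub> b w)"
  "\<zero>\<^bsub>free_algebra K G\<^esub> = (\<lambda>w. \<zero>\<^bsub>K\<^esub>)"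
  "k \<odot>\<^bsub>free_algebra K G\<^esub> a = (\<lambda>w. k \<otimes>\<^bsub>K\<^esub> a w)"
  by (simp_all add: free_algebra_def)

lemma free_algebra_carrier_iff:
  "a \<in> carrier (free_algebra K G) \<longleftrightarrow> (\<forall>w. a w \<in> carrier K) \<and> finite {w. a w \<noteq> \<zero>\<^bsub>K\<^esub>} \<and>
    {w. a w \<noteq> \<zero>\<^bsub>K\<^esub>} \<subseteq> lists G - {[]}"
  by (simp add: free_algebra_def)

lemma free_algebra_carrierD:
  assumes "a \<in> carrier (free_algebra K G)"
  shows "a w \<in> carrier K" "finite {w. a w \<noteq> \<zero>\<^bsub>K\<^esub>}" "{w. a w \<noteq> \<zero>\<^bsub>K\<^esub>} \<subseteq> lists G"
    "a [] = \<zero>\<^bsub>K\<^esub>"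
  using assms unfolding free_algebra_carrier_iff by blast+

text \<open>A finite bound \<open>W\<close> on the support suffices. Cancellation and zero divisors
  can shrink the support of a sum or product, so an exact description would be awkward. The empty
  word is treated separately so that \<open>W\<close> may contain it.\<close>

lemma free_algebra_carrierI:
  assumes "\<And>w. a w \<in> carrier K" "finite W" "W \<subseteq> lists G" "{w. a w \<noteq> \<zero>\<^bsub>K\<^esub>} \<subseteq> W" "a [] = \<zero>\<^bsub>K\<^esub>"
  shows "a \<in> carrier (free_algebra K G)"
proof -
  have "{w. a w \<noteq> \<zero>\<^bsub>K\<^esub>} \<subseteq> lists G - {[]}"
    using assms(3-5) by blast
  then show ?thesis
    using assms(1) finite_subset[OF assms(4,2)] unfolding free_algebra_carrier_iff by blast
qed

context
  fixes K :: "('k, 'm) ring_scheme" (structure) and G :: "'g set"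
  assumes K: "cring K"
begin

interpretation cring K by (fact K)

text \<open>A nonzero coefficient of the product has a nonzero summand, and the cut belonging to
  that summand exhibits the word as a concatenation of two support words.\<close>

lemma free_algebra_mult_support:
  assumes "a \<in> carrier (free_algebra K G)" "b \<in> carrier (free_algebra K G)"
  shows "{w. (a \<otimes>\<^bsub>free_algebra K G\<^esub> b) w \<noteq> \<zero>}
    \<subseteq> (\<lambda>(u, v). u @ v) ` ({w. a w \<noteq> \<zero>} \<times> {w. b w \<noteq> \<zero>})"
proof clarify
  fix w assume w: "(a \<otimes>\<^bsub>free_algebra K G\<^esub> b) w \<noteq> \<zero>"
  then obtain i where "a (take i w) \<otimes> b (drop i w) \<noteq> \<zero>"
    using add.finprod_one_eqI[of "{..length w}" "\<lambda>i. a (take i w) \<otimes> b (drop i w)"]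
    by (auto simp: free_algebra_mult_apply)
  then have "a (take i w) \<noteq> \<zero>" "b (drop i w) \<noteq> \<zero>"
    using free_algebra_carrierD(1)[OF assms(1)] free_algebra_carrierD(1)[OF assms(2)] by auto
  then show "w \<in> (\<lambda>(u, v). u @ v) ` ({w. a w \<noteq> \<zero>} \<times> {w. b w \<noteq> \<zero>})"
    by (intro image_eqI[of _ _ "(take i w, drop i w)"]) auto
qed

lemma free_gen_closed: "g \<in> G \<Longrightarrow> free_gen K g \<in> carrier (free_algebra K G)"
  by (rule free_algebra_carrierI[where W = "{[g]}"]) (auto simp: free_gen_def)

lemma free_algebra_abelian_group: "abelian_group (free_algebra K G)"
proof (rule abelian_groupI)
  fix a b assume ab: "a \<in> carrier (free_algebra K G)" "b \<in> carrier (free_algebra K G)"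
  note [simp] = free_algebra_carrierD(1,4)[OF ab(1)] free_algebra_carrierD(1,4)[OF ab(2)]
  show "a \<oplus>\<^bsub>free_algebra K G\<^esub> b \<in> carrier (free_algebra K G)"
    using free_algebra_carrierD(2,3)[OF ab(1)] free_algebra_carrierD(2,3)[OF ab(2)]
    by (intro free_algebra_carrierI[where W = "{w. a w \<noteq> \<zero>} \<union> {w. b w \<noteq> \<zero>}"])
      (auto simp: free_algebra_simps)
  show "a \<oplus>\<^bsub>free_algebra K G\<^esub> b = b \<oplus>\<^bsub>free_algebra K G\<^esub> a"
    by (simp add: free_algebra_simps a_comm)
  show "\<exists>c\<in>carrier (free_algebra K G). c \<oplus>\<^bsub>free_algebra K G\<^esub> a = \<zero>\<^bsub>free_algebra K G\<^esub>"
  proof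
    show "(\<lambda>w. \<ominus> a w) \<in> carrier (free_algebra K G)"
      using free_algebra_carrierD(2,3)[OF ab(1)]
      by (intro free_algebra_carrierI[where W = "{w. a w \<noteq> \<zero>}"]) auto
    show "(\<lambda>w. \<ominus> a w) \<oplus>\<^bsub>free_algebra K G\<^esub> a = \<zero>\<^bsub>free_algebra K G\<^esub>"
      by (simp add: free_algebra_simps l_neg)
  qed
qed (auto simp: free_algebra_simps free_algebra_carrier_iff a_assoc)

lemma free_algebra_distrib_algebra: "distrib_algebra K (free_algebra K G)"
proof -
  interpret A: abelian_group "free_algebra K G" by (rule free_algebra_abelian_group)
  show ?thesis
  proof
    fix a b assume ab: "a \<in> carrier (free_algebra K G)" "b \<in> carrier (free_algebra K G)"
    note [simp] = free_algebra_carrierD(1,4)[OF ab(1)] free_algebra_carrierD(1,4)[OF ab(2)]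
    show "a \<otimes>\<^bsub>free_algebra K G\<^esub> b \<in> carrier (free_algebra K G)"
    proof (rule free_algebra_carrierI)
      show "finite ((\<lambda>(u, v). u @ v) ` ({w. a w \<noteq> \<zero>} \<times> {w. b w \<noteq> \<zero>}))"
        using free_algebra_carrierD(2) ab by blast
      show "(\<lambda>(u, v). u @ v) ` ({w. a w \<noteq> \<zero>} \<times> {w. b w \<noteq> \<zero>}) \<subseteq> lists G"
        using free_algebra_carrierD(3)[OF ab(1)] free_algebra_carrierD(3)[OF ab(2)] by fastforce
    \<comment> \<open>Among the remaining goals, the coefficient at the empty word is zero: its
      single cut is into two empty words, where both factors vanish.\<close>
    qed (use free_algebra_mult_support[OF ab] in \<open>auto simp: free_algebra_mult_apply\<close>)
  next
    fix k a assume k: "k \<in> carrier K" and a: "a \<in> carrier (free_algebra K G)"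
    note [simp] = k free_algebra_carrierD(1,4)[OF a]
    show "k \<odot>\<^bsub>free_algebra K G\<^esub> a \<in> carrier (free_algebra K G)"
      using free_algebra_carrierD(2,3)[OF a]
      by (intro free_algebra_carrierI[where W = "{w. a w \<noteq> \<zero>}"]) (auto simp: free_algebra_simps)
    fix b assume b: "b \<in> carrier (free_algebra K G)"
    note [simp] = free_algebra_carrierD(1)[OF b]
    show "k \<odot>\<^bsub>free_algebra K G\<^esub> (a \<oplus>\<^bsub>free_algebra K G\<^esub> b)
      = k \<odot>\<^bsub>free_algebra K G\<^esub> a \<oplus>\<^bsub>free_algebra K G\<^esub> k \<odot>\<^bsub>free_algebra K G\<^esub> b"
      by (simp add: free_algebra_simps r_distr)
  next
    fix a b c assume abc: "a \<in> carrier (free_algebra K G)" "b \<in> carrier (free_algebra K G)"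
      "c \<in> carrier (free_algebra K G)"
    note [simp] = free_algebra_carrierD(1)[OF abc(1)] free_algebra_carrierD(1)[OF abc(2)]
      free_algebra_carrierD(1)[OF abc(3)]
    show "(a \<oplus>\<^bsub>free_algebra K G\<^esub> b) \<otimes>\<^bsub>free_algebra K G\<^esub> c
      = a \<otimes>\<^bsub>free_algebra K G\<^esub> c \<oplus>\<^bsub>free_algebra K G\<^esub> b \<otimes>\<^bsub>free_algebra K G\<^esub> c"
      by (intro ext) (simp add: free_algebra_simps free_algebra_mult_apply l_distr finsum_addf)
    show "a \<otimes>\<^bsub>free_algebra K G\<^esub> (b \<oplus>\<^bsub>free_algebra K G\<^esub> c)
      = a \<otimes>\<^bsub>free_algebra K G\<^esub> b \<oplus>\<^bsub>free_algebra K G\<^esub> a \<otimes>\<^bsub>free_algebra K G\<^esub> c"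
      by (intro ext) (simp add: free_algebra_simps free_algebra_mult_apply r_distr finsum_addf)
  qed
qed

end

section \<open>Linear maps\<close>

context Module.module
begin

lemma Hom_algD:
  assumes "T \<in> carrier (Hom_alg R M)" "x \<in> carrier M"
  shows "T x \<in> carrier M"
    and "y \<in> carrier M \<Longrightarrow> T (x \<oplus>\<^bsub>M\<^esub> y) = T x \<oplus>\<^bsub>M\<^esub> T y"
    and "k \<in> carrier R \<Longrightarrow> T (k \<odot>\<^bsub>M\<^esub> x) = k \<odot>\<^bsub>M\<^esub> T x"
  using assms by (auto simp: Hom_alg_def)

lemma Hom_algI:
  assumes "\<And>x. x \<in> carrier M \<Longrightarrow> T x \<in> carrier M"
    and "\<And>x y. \<lbrakk>x \<in> carrier M; y \<in> carrier M\<rbrakk> \<Longrightarrow> T (x \<oplus>\<^bsub>M\<^esub> y) = T x \<oplus>\<^bsub>M\<^esub> T y"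
    and "\<And>k x. \<lbrakk>k \<in> carrier R; x \<in> carrier M\<rbrakk> \<Longrightarrow> T (k \<odot>\<^bsub>M\<^esub> x) = k \<odot>\<^bsub>M\<^esub> T x"
  shows "(\<lambda>x\<in>carrier M. T x) \<in> carrier (Hom_alg R M)"
  using assms by (auto simp: Hom_alg_def)

lemma Hom_alg_eqI:
  assumes "S \<in> carrier (Hom_alg R M)" "T \<in> carrier (Hom_alg R M)"
    and "\<And>x. x \<in> carrier M \<Longrightarrow> S x = T x"
  shows "S = T"
  using assms by (auto simp: Hom_alg_def intro: PiE_ext)

lemma Hom_alg_apply:
  assumes "x \<in> carrier M"
  shows "(S \<oplus>\<^bsub>Hom_alg R M\<^esub> T) x = S x \<oplus>\<^bsub>M\<^esub> T x"
    and "(S \<otimes>\<^bsub>Hom_alg R M\<^esub> T) x = S (T x)"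
    and "(k \<odot>\<^bsub>Hom_alg R M\<^esub> T) x = k \<odot>\<^bsub>M\<^esub> T x"
    and "\<zero>\<^bsub>Hom_alg R M\<^esub> x = \<zero>\<^bsub>M\<^esub>"
  using assms by (simp_all add: Hom_alg_def)

lemma Hom_alg_closed:
  assumes "S \<in> carrier (Hom_alg R M)" "T \<in> carrier (Hom_alg R M)"
  shows "S \<oplus>\<^bsub>Hom_alg R M\<^esub> T \<in> carrier (Hom_alg R M)"
    and "S \<otimes>\<^bsub>Hom_alg R M\<^esub> T \<in> carrier (Hom_alg R M)"
proof -
  note [simp] = Hom_algD[OF assms(1)] Hom_algD[OF assms(2)]
  have "(\<lambda>x\<in>carrier M. S x \<oplus>\<^bsub>M\<^esub> T x) \<in> carrier (Hom_alg R M)"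
    by (rule Hom_algI) (simp_all add: smult_r_distr M.a_ac)
  then show "S \<oplus>\<^bsub>Hom_alg R M\<^esub> T \<in> carrier (Hom_alg R M)" by (simp add: Hom_alg_def)
  have "(\<lambda>x\<in>carrier M. S (T x)) \<in> carrier (Hom_alg R M)"
    by (rule Hom_algI) simp_all
  then show "S \<otimes>\<^bsub>Hom_alg R M\<^esub> T \<in> carrier (Hom_alg R M)" by (simp add: Hom_alg_def)
qed

text \<open>Commutativity of the scalars enters here: k times a linear map must itself commute with
  every other scalar.\<close>

lemma Hom_alg_smult_closed:
  assumes [simp]: "k \<in> carrier R" and T: "T \<in> carrier (Hom_alg R M)"
  shows "k \<odot>\<^bsub>Hom_alg R M\<^esub> T \<in> carrier (Hom_alg R M)"
proof -
  note [simp] = Hom_algD[OF T]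
  have "(\<lambda>x\<in>carrier M. k \<odot>\<^bsub>M\<^esub> T x) \<in> carrier (Hom_alg R M)"
    by (rule Hom_algI) (simp_all add: smult_r_distr smult_assoc1[symmetric] R.m_comm)
  then show "k \<odot>\<^bsub>Hom_alg R M\<^esub> T \<in> carrier (Hom_alg R M)" by (simp add: Hom_alg_def)
qed

lemma Hom_alg_abelian_group: "abelian_group (Hom_alg R M)"
proof (rule abelian_groupI)
  have "(\<lambda>x\<in>carrier M. \<zero>\<^bsub>M\<^esub>) \<in> carrier (Hom_alg R M)"
    by (rule Hom_algI) simp_all
  then show zero: "\<zero>\<^bsub>Hom_alg R M\<^esub> \<in> carrier (Hom_alg R M)" by (simp add: Hom_alg_def)
  fix S assume S: "S \<in> carrier (Hom_alg R M)"
  note [simp] = Hom_algD[OF S]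
  show "\<zero>\<^bsub>Hom_alg R M\<^esub> \<oplus>\<^bsub>Hom_alg R M\<^esub> S = S"
    using S zero by (intro Hom_alg_eqI) (auto simp: Hom_alg_closed Hom_alg_apply)
  show "\<exists>T\<in>carrier (Hom_alg R M). T \<oplus>\<^bsub>Hom_alg R M\<^esub> S = \<zero>\<^bsub>Hom_alg R M\<^esub>"
  proof
    show T: "(\<lambda>x\<in>carrier M. \<ominus>\<^bsub>M\<^esub> S x) \<in> carrier (Hom_alg R M)"
      by (rule Hom_algI) (simp_all add: M.minus_add smult_r_minus)
    show "(\<lambda>x\<in>carrier M. \<ominus>\<^bsub>M\<^esub> S x) \<oplus>\<^bsub>Hom_alg R M\<^esub> S = \<zero>\<^bsub>Hom_alg R M\<^esub>"
      using S T zero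
      by (intro Hom_alg_eqI) (auto simp: Hom_alg_closed Hom_alg_apply M.l_neg)
  qed
  fix T assume T: "T \<in> carrier (Hom_alg R M)"
  show "S \<oplus>\<^bsub>Hom_alg R M\<^esub> T \<in> carrier (Hom_alg R M)" by (rule Hom_alg_closed[OF S T])
  show "S \<oplus>\<^bsub>Hom_alg R M\<^esub> T = T \<oplus>\<^bsub>Hom_alg R M\<^esub> S"
    using S T by (intro Hom_alg_eqI) (auto simp: Hom_alg_closed Hom_alg_apply Hom_algD M.a_comm)
  fix U assume U: "U \<in> carrier (Hom_alg R M)"
  show "S \<oplus>\<^bsub>Hom_alg R M\<^esub> T \<oplus>\<^bsub>Hom_alg R M\<^esub> U = S \<oplus>\<^bsub>Hom_alg R M\<^esub> (T \<oplus>\<^bsub>Hom_alg R M\<^esub> U)"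
    using S T U
    by (intro Hom_alg_eqI) (auto simp: Hom_alg_closed Hom_alg_apply Hom_algD M.a_assoc)
qed

lemma Hom_alg_distrib_algebra: "distrib_algebra R (Hom_alg R M)"
proof -
  interpret H: abelian_group "Hom_alg R M" by (rule Hom_alg_abelian_group)
  show ?thesis
    by unfold_locales
      (auto intro!: Hom_alg_eqI simp: Hom_alg_closed Hom_alg_smult_closed Hom_alg_apply Hom_algD smult_r_distr)
qed

lemma Hom_alg_hom_finsum:
  assumes T: "T \<in> carrier (Hom_alg R M)" and "finite A" "g \<in> A \<rightarrow> carrier M"
  shows "T (\<Oplus>\<^bsub>M\<^esub>i\<in>A. g i) = (\<Oplus>\<^bsub>M\<^esub>i\<in>A. T (g i))"
  using assms M.abelian_group_axioms
  by (intro M.hom_finsum_group) (auto simp: hom_def Hom_algD)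

end

section \<open>Evaluation of the free algebra at linear maps\<close>

locale free_action = Module.module R M for R (structure) and M (structure) +
  fixes G :: "'g set" and T :: "'g \<Rightarrow> 'c \<Rightarrow> 'c"
  assumes T_Hom: "g \<in> G \<Longrightarrow> T g \<in> carrier (Hom_alg R M)"
begin

text \<open>The first letter of a word acts last, so \<open>foldr\<close> turns concatenation of
  words into composition of operators in the same order.\<close>

definition eval :: "('g list \<Rightarrow> 'a) \<Rightarrow> 'c \<Rightarrow> 'c" where
  "eval a = (\<lambda>x\<in>carrier M. \<Oplus>\<^bsub>M\<^esub>w\<in>{w. a w \<noteq> \<zero>}. a w \<odot>\<^bsub>M\<^esub> foldr T w x)"

lemma word_closed: "\<lbrakk>w \<in> lists G; x \<in> carrier M\<rbrakk> \<Longrightarrow> foldr T w x \<in> carrier M"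
  by (induction w) (auto intro: Hom_algD T_Hom)

text \<open>The restriction to the carrier supplies the extensionality that \<open>Hom_alg\<close>
  demands; already for the empty word, \<open>foldr T w\<close> is the identity on the whole
  type.\<close>

lemma word_linear: "w \<in> lists G \<Longrightarrow> (\<lambda>x\<in>carrier M. foldr T w x) \<in> carrier (Hom_alg R M)"
proof (induction w)
  case Nil
  then show ?case by (intro Hom_algI) auto
next
  case (Cons g w)
  then have gw: "g \<in> G" "w \<in> lists G" by auto
  have eq: "T g \<otimes>\<^bsub>Hom_alg R M\<^esub> (\<lambda>x\<in>carrier M. foldr T w x) = (\<lambda>x\<in>carrier M. foldr T (g # w) x)"
    by (auto simp: Hom_alg_def)
  then show ?case
    using Hom_alg_closed(2)[OF T_Hom[OF gw(1)] Cons.IH[OF gw(2)]] by (simp only: eq)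
qed

lemma word_add:
  "\<lbrakk>w \<in> lists G; x \<in> carrier M; y \<in> carrier M\<rbrakk>
    \<Longrightarrow> foldr T w (x \<oplus>\<^bsub>M\<^esub> y) = foldr T w x \<oplus>\<^bsub>M\<^esub> foldr T w y"
  using Hom_algD(2)[OF word_linear, of w x y] by simp

lemma word_smult:
  "\<lbrakk>w \<in> lists G; x \<in> carrier M; k \<in> carrier R\<rbrakk>
    \<Longrightarrow> foldr T w (k \<odot>\<^bsub>M\<^esub> x) = k \<odot>\<^bsub>M\<^esub> foldr T w x"
  using Hom_algD(3)[OF word_linear, of w x k] by simp

lemma word_finsum:
  "\<lbrakk>w \<in> lists G; finite A; g \<in> A \<rightarrow> carrier M\<rbrakk>
    \<Longrightarrow> foldr T w (\<Oplus>\<^bsub>M\<^esub>i\<in>A. g i) = (\<Oplus>\<^bsub>M\<^esub>i\<in>A. foldr T w (g i))"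
  using Hom_alg_hom_finsum[OF word_linear, of w A g] word_closed
  by (simp add: Pi_def M.finsum_closed cong: M.finsum_cong)

text \<open>Words with coefficient zero contribute nothing, so the support may be enlarged to any
  finite set of words. This allows elements with different supports to be summed over one index
  set.\<close>

lemma eval_eq:
  assumes "a \<in> carrier (free_algebra R G)" "x \<in> carrier M"
    and "finite W" "{w. a w \<noteq> \<zero>} \<subseteq> W" "W \<subseteq> lists G"
  shows "eval a x = (\<Oplus>\<^bsub>M\<^esub>w\<in>W. a w \<odot>\<^bsub>M\<^esub> foldr T w x)"
  using assms word_closed free_algebra_carrierD(1)[OF assms(1)]
  by (auto simp: eval_def subset_iff intro!: M.add.finprod_mono_neutral_cong_left)

lemma eval_add:
  assumes a: "a \<in> carrier (free_algebra R G)" and b: "b \<in> carrier (free_algebra R G)"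
    and x: "x \<in> carrier M"
  shows "eval (a \<oplus>\<^bsub>free_algebra R G\<^esub> b) x = eval a x \<oplus>\<^bsub>M\<^esub> eval b x"
proof -
  interpret A: abelian_group "free_algebra R G" by (rule free_algebra_abelian_group[OF R.is_cring])
  note aD = free_algebra_carrierD[OF a] and bD = free_algebra_carrierD[OF b]
  \<comment> \<open>The support of the sum may be smaller than this union because of cancellation;
    the union indexes all three evaluations at once.\<close>
  define W where "W = {w. a w \<noteq> \<zero>} \<union> {w. b w \<noteq> \<zero>}"
  have W: "finite W" "W \<subseteq> lists G" using aD bD by (auto simp: W_def)
  have ab: "(a \<oplus>\<^bsub>free_algebra R G\<^esub> b) w = a w \<oplus> b w" for w
    by (simp add: free_algebra_simps)
  have word: "foldr T w x \<in> carrier M" if "w \<in> W" for w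
    using W(2) x that by (intro word_closed) auto
  have "eval (a \<oplus>\<^bsub>free_algebra R G\<^esub> b) x = (\<Oplus>\<^bsub>M\<^esub>w\<in>W. (a w \<oplus> b w) \<odot>\<^bsub>M\<^esub> foldr T w x)"
    unfolding ab[symmetric] using a b x W
    by (intro eval_eq) (auto simp: ab W_def)
  also have "\<dots> = (\<Oplus>\<^bsub>M\<^esub>w\<in>W. a w \<odot>\<^bsub>M\<^esub> foldr T w x \<oplus>\<^bsub>M\<^esub> b w \<odot>\<^bsub>M\<^esub> foldr T w x)"
    using aD(1) bD(1) word by (intro M.finsum_cong') (auto simp: smult_l_distr)
  also have "\<dots> = (\<Oplus>\<^bsub>M\<^esub>w\<in>W. a w \<odot>\<^bsub>M\<^esub> foldr T w x) \<oplus>\<^bsub>M\<^esub> (\<Oplus>\<^bsub>M\<^esub>w\<in>W. b w \<odot>\<^bsub>M\<^esub> foldr T w x)"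
    using aD(1) bD(1) word by (intro M.finsum_addf) auto
  also have "\<dots> = eval a x \<oplus>\<^bsub>M\<^esub> eval b x"
    using eval_eq[OF a x W(1) _ W(2)] eval_eq[OF b x W(1) _ W(2)] by (auto simp: W_def)
  finally show ?thesis .
qed

lemma eval_smult:
  assumes k: "k \<in> carrier R" and a: "a \<in> carrier (free_algebra R G)" and x: "x \<in> carrier M"
  shows "eval (k \<odot>\<^bsub>free_algebra R G\<^esub> a) x = k \<odot>\<^bsub>M\<^esub> eval a x"
proof -
  interpret A: distrib_algebra R "free_algebra R G"
    by (rule free_algebra_distrib_algebra[OF R.is_cring])
  note aD = free_algebra_carrierD[OF a]
  define W where "W = {w. a w \<noteq> \<zero>}"
  have W: "finite W" "W \<subseteq> lists G" using aD by (auto simp: W_def)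
  have ka: "(k \<odot>\<^bsub>free_algebra R G\<^esub> a) w = k \<otimes> a w" for w
    by (simp add: free_algebra_simps)
  have word: "foldr T w x \<in> carrier M" if "w \<in> W" for w
    using W(2) x that by (intro word_closed) auto
  have "eval (k \<odot>\<^bsub>free_algebra R G\<^esub> a) x = (\<Oplus>\<^bsub>M\<^esub>w\<in>W. (k \<otimes> a w) \<odot>\<^bsub>M\<^esub> foldr T w x)"
    unfolding ka[symmetric] using k a x W
    by (intro eval_eq) (auto simp: ka W_def A.smult_closed)
  also have "\<dots> = (\<Oplus>\<^bsub>M\<^esub>w\<in>W. k \<odot>\<^bsub>M\<^esub> (a w \<odot>\<^bsub>M\<^esub> foldr T w x))"
    using k aD(1) word by (intro M.finsum_cong') (auto simp: smult_assoc1)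
  also have "\<dots> = k \<odot>\<^bsub>M\<^esub> (\<Oplus>\<^bsub>M\<^esub>w\<in>W. a w \<odot>\<^bsub>M\<^esub> foldr T w x)"
    using k W aD(1) word by (intro finsum_smult_ldistr[symmetric]) auto
  also have "\<dots> = k \<odot>\<^bsub>M\<^esub> eval a x"
    using eval_eq[OF a x W(1) _ W(2)] by (auto simp: W_def)
  finally show ?thesis .
qed

lemma eval_linear:
  assumes a: "a \<in> carrier (free_algebra R G)"
  shows "eval a \<in> carrier (Hom_alg R M)"
proof -
  note aD = free_algebra_carrierD[OF a]
  have word: "foldr T w x \<in> carrier M" if "a w \<noteq> \<zero>" "x \<in> carrier M" for w x
    using aD(3) that by (intro word_closed) auto
  show ?thesis
    unfolding eval_def
  proof (rule Hom_algI)
    fix x assume x: "x \<in> carrier M"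
    show "(\<Oplus>\<^bsub>M\<^esub>w\<in>{w. a w \<noteq> \<zero>}. a w \<odot>\<^bsub>M\<^esub> foldr T w x) \<in> carrier M"
      using aD(1) word x by (intro M.finsum_closed) auto
    fix y assume y: "y \<in> carrier M"
    have "(\<Oplus>\<^bsub>M\<^esub>w\<in>{w. a w \<noteq> \<zero>}. a w \<odot>\<^bsub>M\<^esub> foldr T w (x \<oplus>\<^bsub>M\<^esub> y))
      = (\<Oplus>\<^bsub>M\<^esub>w\<in>{w. a w \<noteq> \<zero>}. a w \<odot>\<^bsub>M\<^esub> foldr T w x \<oplus>\<^bsub>M\<^esub> a w \<odot>\<^bsub>M\<^esub> foldr T w y)"
      using aD(1,3) word x y
      by (intro M.finsum_cong') (auto simp: word_add smult_r_distr subset_iff)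
    also have "\<dots> = (\<Oplus>\<^bsub>M\<^esub>w\<in>{w. a w \<noteq> \<zero>}. a w \<odot>\<^bsub>M\<^esub> foldr T w x)
      \<oplus>\<^bsub>M\<^esub> (\<Oplus>\<^bsub>M\<^esub>w\<in>{w. a w \<noteq> \<zero>}. a w \<odot>\<^bsub>M\<^esub> foldr T w y)"
      using aD(1) word x y by (intro M.finsum_addf) auto
    finally show "(\<Oplus>\<^bsub>M\<^esub>w\<in>{w. a w \<noteq> \<zero>}. a w \<odot>\<^bsub>M\<^esub> foldr T w (x \<oplus>\<^bsub>M\<^esub> y))
      = (\<Oplus>\<^bsub>M\<^esub>w\<in>{w. a w \<noteq> \<zero>}. a w \<odot>\<^bsub>M\<^esub> foldr T w x)
      \<oplus>\<^bsub>M\<^esub> (\<Oplus>\<^bsub>M\<^esub>w\<in>{w. a w \<noteq> \<zero>}. a w \<odot>\<^bsub>M\<^esub> foldr T w y)" .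
  next
    fix k x assume k: "k \<in> carrier R" and x: "x \<in> carrier M"
    have "a w \<odot>\<^bsub>M\<^esub> foldr T w (k \<odot>\<^bsub>M\<^esub> x) = k \<odot>\<^bsub>M\<^esub> (a w \<odot>\<^bsub>M\<^esub> foldr T w x)" if "a w \<noteq> \<zero>" for w
    proof -
      have "w \<in> lists G" using aD(3) that by auto
      then show ?thesis
        using k x aD(1)[of w] word[OF that x]
        by (simp add: word_smult smult_assoc1[symmetric] R.m_comm)
    qed
    then have "(\<Oplus>\<^bsub>M\<^esub>w\<in>{w. a w \<noteq> \<zero>}. a w \<odot>\<^bsub>M\<^esub> foldr T w (k \<odot>\<^bsub>M\<^esub> x))
      = (\<Oplus>\<^bsub>M\<^esub>w\<in>{w. a w \<noteq> \<zero>}. k \<odot>\<^bsub>M\<^esub> (a w \<odot>\<^bsub>M\<^esub> foldr T w x))"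
      using aD(1) word k x by (intro M.finsum_cong') auto
    also have "\<dots> = k \<odot>\<^bsub>M\<^esub> (\<Oplus>\<^bsub>M\<^esub>w\<in>{w. a w \<noteq> \<zero>}. a w \<odot>\<^bsub>M\<^esub> foldr T w x)"
      using aD(1,2) word k x by (intro finsum_smult_ldistr[symmetric]) auto
    finally show "(\<Oplus>\<^bsub>M\<^esub>w\<in>{w. a w \<noteq> \<zero>}. a w \<odot>\<^bsub>M\<^esub> foldr T w (k \<odot>\<^bsub>M\<^esub> x))
      = k \<odot>\<^bsub>M\<^esub> (\<Oplus>\<^bsub>M\<^esub>w\<in>{w. a w \<noteq> \<zero>}. a w \<odot>\<^bsub>M\<^esub> foldr T w x)" .
  qed
qed

text \<open>Both sides are the sum, over pairs of support words, of the product of the coefficients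
  times the composed action. The left side groups the pairs by their concatenation, the right side
  by their first component. Since different pairs may concatenate to the same word, the grouping on
  the left has to record the cut position as well.\<close>

lemma eval_mult:
  assumes a: "a \<in> carrier (free_algebra R G)" and b: "b \<in> carrier (free_algebra R G)"
    and x: "x \<in> carrier M"
  shows "eval (a \<otimes>\<^bsub>free_algebra R G\<^esub> b) x = eval a (eval b x)"
proof -
  interpret A: distrib_algebra R "free_algebra R G"
    by (rule free_algebra_distrib_algebra[OF R.is_cring])
  note aD = free_algebra_carrierD[OF a] and bD = free_algebra_carrierD[OF b]
  define SA SB where "SA = {w. a w \<noteq> \<zero>}" and "SB = {w. b w \<noteq> \<zero>}"
  have S: "finite SA" "SA \<subseteq> lists G" "finite SB" "SB \<subseteq> lists G"
    using aD bD by (auto simp: SA_def SB_def)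
  define W where "W = (\<lambda>(u, v). u @ v) ` (SA \<times> SB)"
  have W: "finite W" "W \<subseteq> lists G"
    using S by (force simp: W_def)+
  define t where "t = (\<lambda>(u, v). (a u \<otimes> b v) \<odot>\<^bsub>M\<^esub> foldr T u (foldr T v x))"
  \<comment> \<open>\<open>cut\<close> embeds \<open>C\<close> into the pairs of words; its image contains \<open>SA \<times> SB\<close>, and \<open>t\<close> vanishes
    on the rest, so both iterated sums equal the sum of \<open>t\<close> over \<open>SA \<times> SB\<close>.\<close>
  define C where "C = Sigma W (\<lambda>w. {..length w})"
  define cut where "cut = (\<lambda>(w, i). (take i w, drop i w) :: 'g list \<times> 'g list)"
  have t_closed: "t (u, v) \<in> carrier M" if "u \<in> lists G" "v \<in> lists G" for u v
    using that x aD(1) bD(1) by (simp add: t_def word_closed)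
  have take_drop: "take i w \<in> lists G" "drop i w \<in> lists G" if "w \<in> W" for i w
    using that W(2) by (auto dest: in_set_takeD in_set_dropD)
  have cut_closed: "t (cut p) \<in> carrier M" if "p \<in> C" for p
    using that take_drop t_closed by (auto simp: C_def cut_def)
  have inj: "inj_on cut C"
  proof (rule inj_onI)
    fix p q assume pq: "p \<in> C" "q \<in> C" "cut p = cut q"
    obtain w i w' j where p: "p = (w, i)" and q: "q = (w', j)" by force
    have "w = w'"
      using pq(3) append_take_drop_id[of i w] append_take_drop_id[of j w']
      by (simp add: p q cut_def)
    \<comment> \<open>Both positions are at most the length of the word, so the length of the prefix
      recovers the position; beyond that bound \<open>take\<close> would truncate and injectivity
      would fail.\<close>
    moreover have "length (take i w) = length (take j w')"
      using pq(3) by (simp add: p q cut_def)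
    ultimately show "p = q" using pq(1,2) by (auto simp: C_def p q)
  qed
  have sub: "SA \<times> SB \<subseteq> cut ` C"
  proof clarify
    fix u v assume "u \<in> SA" "v \<in> SB"
    then show "(u, v) \<in> cut ` C"
      by (intro image_eqI[of _ _ "(u @ v, length u)"]) (auto simp: C_def W_def cut_def)
  qed
  have "eval (a \<otimes>\<^bsub>free_algebra R G\<^esub> b) x
      = (\<Oplus>\<^bsub>M\<^esub>w\<in>W. (a \<otimes>\<^bsub>free_algebra R G\<^esub> b) w \<odot>\<^bsub>M\<^esub> foldr T w x)"
    using free_algebra_mult_support[OF R.is_cring a b] a b x W
    by (intro eval_eq) (auto simp: A.mult_closed W_def SA_def SB_def)
  also have "\<dots> = (\<Oplus>\<^bsub>M\<^esub>w\<in>W. \<Oplus>\<^bsub>M\<^esub>i\<in>{..length w}. t (cut (w, i)))"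
  proof (intro M.finsum_cong' refl)
    fix w assume w: "w \<in> W"
    have "(a \<otimes>\<^bsub>free_algebra R G\<^esub> b) w \<odot>\<^bsub>M\<^esub> foldr T w x
      = (\<Oplus>\<^bsub>M\<^esub>i\<in>{..length w}. (a (take i w) \<otimes> b (drop i w)) \<odot>\<^bsub>M\<^esub> foldr T w x)"
      unfolding free_algebra_mult_apply using w W x aD(1) bD(1)
      by (intro finsum_smult_rdistr) (auto intro!: word_closed)
    also have "\<dots> = (\<Oplus>\<^bsub>M\<^esub>i\<in>{..length w}. t (cut (w, i)))"
    proof (intro M.finsum_cong' refl)
      fix i
      show "(a (take i w) \<otimes> b (drop i w)) \<odot>\<^bsub>M\<^esub> foldr T w x = t (cut (w, i))"
        using foldr_append[of T "take i w" "drop i w" x] by (simp add: t_def cut_def)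
    qed (use w cut_closed in \<open>auto simp: C_def\<close>)
    finally show "(a \<otimes>\<^bsub>free_algebra R G\<^esub> b) w \<odot>\<^bsub>M\<^esub> foldr T w x
      = (\<Oplus>\<^bsub>M\<^esub>i\<in>{..length w}. t (cut (w, i)))" .
  qed (use cut_closed in \<open>auto simp: C_def intro!: M.finsum_closed\<close>)
  also have "\<dots> = (\<Oplus>\<^bsub>M\<^esub>p\<in>C. t (cut p))"
    unfolding C_def using W cut_closed by (intro M.finsum_Sigma) (auto simp: C_def)
  also have "\<dots> = (\<Oplus>\<^bsub>M\<^esub>q\<in>cut ` C. t q)"
    using inj cut_closed by (intro M.finsum_reindex[symmetric]) auto
  also have "\<dots> = (\<Oplus>\<^bsub>M\<^esub>q\<in>SA \<times> SB. t q)"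
  proof (rule M.add.finprod_mono_neutral_cong_right)
    show "finite (cut ` C)" using W by (simp add: C_def)
    show "SA \<times> SB \<subseteq> cut ` C" by (rule sub)
    show "t \<in> cut ` C \<rightarrow> carrier M" using cut_closed by auto
    fix q assume q: "q \<in> cut ` C - SA \<times> SB"
    then obtain u v where uv: "q = (u, v)" "u \<in> lists G" "v \<in> lists G"
      using take_drop by (auto simp: C_def cut_def)
    have "a u \<otimes> b v = \<zero>"
      using q uv(1) aD(1)[of u] bD(1)[of v] by (auto simp: SA_def SB_def)
    then show "t q = \<zero>\<^bsub>M\<^esub>" using uv x by (simp add: t_def word_closed)
  qed simp
  also have "\<dots> = (\<Oplus>\<^bsub>M\<^esub>u\<in>SA. \<Oplus>\<^bsub>M\<^esub>v\<in>SB. t (u, v))"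
    using S(1,3) t_closed subsetD[OF S(2)] subsetD[OF S(4)]
    by (intro M.finsum_Sigma[symmetric]) blast+
  also have "\<dots> = (\<Oplus>\<^bsub>M\<^esub>u\<in>SA. a u \<odot>\<^bsub>M\<^esub> foldr T u (\<Oplus>\<^bsub>M\<^esub>v\<in>SB. b v \<odot>\<^bsub>M\<^esub> foldr T v x))"
  proof (intro M.finsum_cong' refl)
    fix u assume u: "u \<in> SA"
    then have uG: "u \<in> lists G" using S by auto
    have closed: "b v \<odot>\<^bsub>M\<^esub> foldr T v x \<in> carrier M" if "v \<in> SB" for v
      using that S x bD(1) by (intro smult_closed word_closed) auto
    \<comment> \<open>Linearity of the action of \<open>u\<close> lets the scalar \<open>b v\<close>
      pass through it, which isolates the part depending on \<open>v\<close>.\<close>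
    have "t (u, v) = a u \<odot>\<^bsub>M\<^esub> foldr T u (b v \<odot>\<^bsub>M\<^esub> foldr T v x)" if "v \<in> SB" for v
    proof -
      have "v \<in> lists G" using that S by auto
      then show ?thesis
        using uG x aD(1)[of u] bD(1)[of v] by (simp add: t_def word_smult word_closed smult_assoc1)
    qed
    then have "(\<Oplus>\<^bsub>M\<^esub>v\<in>SB. t (u, v)) = (\<Oplus>\<^bsub>M\<^esub>v\<in>SB. a u \<odot>\<^bsub>M\<^esub> foldr T u (b v \<odot>\<^bsub>M\<^esub> foldr T v x))"
      using closed uG aD(1) by (intro M.finsum_cong') (auto simp: word_closed)
    also have "\<dots> = a u \<odot>\<^bsub>M\<^esub> (\<Oplus>\<^bsub>M\<^esub>v\<in>SB. foldr T u (b v \<odot>\<^bsub>M\<^esub> foldr T v x))"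
      using closed uG S aD(1) by (intro finsum_smult_ldistr[symmetric]) (auto simp: word_closed)
    also have "(\<Oplus>\<^bsub>M\<^esub>v\<in>SB. foldr T u (b v \<odot>\<^bsub>M\<^esub> foldr T v x))
      = foldr T u (\<Oplus>\<^bsub>M\<^esub>v\<in>SB. b v \<odot>\<^bsub>M\<^esub> foldr T v x)"
      using closed uG S by (intro word_finsum[symmetric]) auto
    finally show "(\<Oplus>\<^bsub>M\<^esub>v\<in>SB. t (u, v))
      = a u \<odot>\<^bsub>M\<^esub> foldr T u (\<Oplus>\<^bsub>M\<^esub>v\<in>SB. b v \<odot>\<^bsub>M\<^esub> foldr T v x)" .
  next
    have "(\<Oplus>\<^bsub>M\<^esub>v\<in>SB. b v \<odot>\<^bsub>M\<^esub> foldr T v x) \<in> carrier M"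
      using S x bD(1) by (intro M.finsum_closed) (auto intro!: smult_closed word_closed)
    then show "(\<lambda>u. a u \<odot>\<^bsub>M\<^esub> foldr T u (\<Oplus>\<^bsub>M\<^esub>v\<in>SB. b v \<odot>\<^bsub>M\<^esub> foldr T v x)) \<in> SA \<rightarrow> carrier M"
      using S aD(1) by (auto intro!: smult_closed word_closed)
  qed
  also have "\<dots> = eval a (eval b x)"
    using Hom_algD(1)[OF eval_linear[OF b] x] x by (simp add: eval_def SA_def SB_def)
  finally show ?thesis .
qed

lemma eval_free_gen:
  assumes g: "g \<in> G"
  shows "eval (free_gen R g) = T g"
proof (cases "\<one> = \<zero>")
  \<comment> \<open>Over the zero ring \<open>free_gen\<close> has empty support and evaluates to
    zero, but then every y = 1 y = 0 y is zero too, so the module is trivial and all operators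
    agree.\<close>
  case True
  have "y = \<zero>\<^bsub>M\<^esub>" if "y \<in> carrier M" for y
    using smult_one[OF that] smult_l_null[OF that] True by simp
  then show ?thesis
    using eval_linear[OF free_gen_closed[OF R.is_cring g]] T_Hom[OF g]
    by (intro Hom_alg_eqI) (metis Hom_algD(1))+
next
  case False
  show ?thesis
  proof (rule Hom_alg_eqI[OF eval_linear[OF free_gen_closed[OF R.is_cring g]] T_Hom[OF g]])
    fix x assume x: "x \<in> carrier M"
    have "{w. free_gen R g w \<noteq> \<zero>} = {[g]}" using False by (auto simp: free_gen_def)
    then show "eval (free_gen R g) x = T g x"
      using x Hom_algD(1)[OF T_Hom[OF g] x] by (simp add: eval_def free_gen_def)
  qed
qed

lemma eval_algebra_hom: "eval \<in> algebra_hom R (free_algebra R G) (Hom_alg R M)"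
proof -
  interpret A: distrib_algebra R "free_algebra R G"
    by (rule free_algebra_distrib_algebra[OF R.is_cring])
  show ?thesis
    unfolding algebra_hom_def hom_def
    by (auto intro!: Hom_alg_eqI
        simp: eval_linear Hom_alg_closed Hom_alg_smult_closed Hom_alg_apply A.mult_closed A.smult_closed
          eval_add eval_mult eval_smult)
qed

end

section \<open>The operators of a branching system\<close>

lemma fun_module_module:
  assumes "cring K"
  shows "Module.module K (fun_module K X)"
proof -
  interpret K: cring K by fact
  note mem = PiE_mem[of _ X "\<lambda>_. carrier K"]
  have "abelian_group (fun_module K X)"
  proof (rule abelian_groupI)
    fix a assume a: "a \<in> carrier (fun_module K X)"
    then show "\<exists>c\<in>carrier (fun_module K X). c \<oplus>\<^bsub>fun_module K X\<^esub> a = \<zero>\<^bsub>fun_module K X\<^esub>"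
      by (intro bexI[of _ "\<lambda>x\<in>X. \<ominus>\<^bsub>K\<^esub> a x"])
        (auto simp: fun_module_def K.l_neg mem cong: restrict_cong)
    show "\<zero>\<^bsub>fun_module K X\<^esub> \<oplus>\<^bsub>fun_module K X\<^esub> a = a"
      using a by (auto simp: fun_module_def mem intro!: PiE_ext[of _ X "\<lambda>_. carrier K"])
  qed (auto simp: fun_module_def K.a_ac mem intro!: restrict_ext)
  then show ?thesis
    by (intro Module.moduleI assms)
      (auto simp: fun_module_def K.l_distr K.r_distr K.m_assoc mem
        intro!: restrict_ext PiE_ext[of _ X "\<lambda>_. carrier K"])
qed

section \<open>The representation of the Leavitt path algebra\<close>

theorem theorem2p2:
  fixes K :: "('k, 'm) ring_scheme"
    and E :: "('v, 'e) pre_digraph"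
    and X :: "'x set"
    and R :: "'e \<Rightarrow> 'x set"
    and D :: "'v \<Rightarrow> 'x set"
    and f :: "'e \<Rightarrow> 'x \<Rightarrow> 'x"
  assumes "field K"
    and "wf_digraph E" and "countable (verts E)" and "countable (arcs E)"
    and "branching_system E X R D f"
  shows "\<exists>\<pi> \<in> algebra_hom K (leavitt_path_algebra K E) (Hom_alg K (fun_module K X)).
    (\<forall>e\<in>arcs E. \<pi> (lpa_elem K E (Edge e)) = S_op K E X R D f e \<and>
                \<pi> (lpa_elem K E (Ghost e)) = S_star_op K E X D f e) \<and>
    (\<forall>v\<in>verts E. \<pi> (lpa_elem K E (Vert v)) = P_op K X D v)"
proof -
  interpret K: field K by fact
  interpret G: wf_digraph E by fact
  interpret B: branching_system E X R D f by fact
  interpret M: Module.module K "fun_module K X" by (rule fun_module_module) (rule K.is_cring)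
  define T where "T g = (case g of Vert v \<Rightarrow> P_op K X D v
    | Edge e \<Rightarrow> S_op K E X R D f e | Ghost e \<Rightarrow> S_star_op K E X D f e)" for g
  let ?M = "fun_module K X" and ?A = "lpa_free K E" and ?H = "Hom_alg K (fun_module K X)"
  have mem: "\<phi> x \<in> carrier K" if "\<phi> \<in> carrier ?M" "x \<in> X" for \<phi> x
    using that by (auto simp: fun_module_def)
  have fun_eqI: "\<phi> = \<psi>"
    if "\<phi> \<in> carrier ?M" "\<psi> \<in> carrier ?M" "\<And>x. x \<in> X \<Longrightarrow> \<phi> x = \<psi> x" for \<phi> \<psi>
    using that by (auto simp: fun_module_def intro: PiE_ext)
  have f_in: "f e x \<in> R e" "f e x \<in> X" if "e \<in> arcs E" "x \<in> D (head E e)" for e x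
    using that bij_betwE[OF B.f_bij] B.R_subset by blast+
  have inv_in: "inv_into (D (head E e)) (f e) x \<in> D (head E e)"
    "inv_into (D (head E e)) (f e) x \<in> X" "f e (inv_into (D (head E e)) (f e) x) = x"
    if "e \<in> arcs E" "x \<in> R e" for e x
    using that B.f_bij[OF that(1)] B.D_subset[of "head E e"]
    by (auto simp: bij_betw_def inv_into_into f_inv_into_f)
  have inv_f: "inv_into (D (head E e)) (f e) (f e x) = x"
    if "e \<in> arcs E" "x \<in> D (head E e)" for e x
    using that B.f_bij[OF that(1)] by (auto simp: bij_betw_def)
  have T_Hom: "T g \<in> carrier ?H" if g: "g \<in> lpa_gens E" for g
  proof -
    \<comment> \<open>All three operators have one shape: pull back along a map \<open>h\<close>
      from a subset \<open>Y\<close> to \<open>X\<close>, and extend by zero. Here \<open>h\<close>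
      is the inverse of \<open>f e\<close> on \<open>R e\<close>, \<open>f e\<close> on
      \<open>D (head E e)\<close>, or the identity on \<open>D v\<close>.\<close>
    have "(\<lambda>\<phi>\<in>carrier ?M. \<lambda>x\<in>X. if x \<in> Y then \<phi> (h x) else \<zero>\<^bsub>K\<^esub>) \<in> carrier ?H"
      if h: "\<And>x. x \<in> Y \<Longrightarrow> h x \<in> X" for Y h
      using h by (intro M.Hom_algI) (auto simp: fun_module_def PiE_iff intro!: restrict_ext)
    from this[of "R e" "inv_into (D (head E e)) (f e)" for e] this[of "D (head E e)" "f e" for e]
      this[of "D v" "\<lambda>x. x" for v] g f_in inv_in B.D_subset
    show ?thesis
      by (auto simp: T_def lpa_gens_def S_op_def S_star_op_def P_op_def subset_iff)
  qed
  interpret F: free_action K ?M "lpa_gens E" T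
    by unfold_locales (rule T_Hom)
  interpret A: distrib_algebra K ?A by (rule free_algebra_distrib_algebra) (rule K.is_cring)
  interpret H: distrib_algebra K ?H by (rule M.Hom_alg_distrib_algebra)
  note gen = free_gen_closed[OF K.is_cring, of _ "lpa_gens E"]
  have gens: "v \<in> verts E \<Longrightarrow> Vert v \<in> lpa_gens E" "e \<in> arcs E \<Longrightarrow> Edge e \<in> lpa_gens E"
    "e \<in> arcs E \<Longrightarrow> Ghost e \<in> lpa_gens E" for v e
    by (auto simp: lpa_gens_def)
  have ev_hom: "F.eval \<in> hom (add_monoid ?A) (add_monoid ?H)"
    using F.eval_algebra_hom by (simp add: algebra_hom_def)
  have ev_mult: "F.eval (free_gen K g \<otimes>\<^bsub>?A\<^esub> free_gen K h) = T g \<otimes>\<^bsub>?H\<^esub> T h"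
    if "g \<in> lpa_gens E" "h \<in> lpa_gens E" for g h
    using F.eval_algebra_hom that by (simp add: algebra_hom_def hom_def gen F.eval_free_gen)
  \<comment> \<open>Relators are differences, so each relation turns into an equality of
    operators.\<close>
  have ker_minus: "a \<ominus>\<^bsub>?A\<^esub> b \<in> a_kernel ?A ?H F.eval"
    if "a \<in> carrier ?A" "b \<in> carrier ?A" "F.eval a = F.eval b" for a b
    using that A.hom_a_minus[OF H.abelian_group_axioms ev_hom, of a b] F.eval_linear[of b]
    by (simp add: a_kernel_eq a_minus_def H.r_neg)
  have T_eqI: "S = U" if "S \<in> carrier ?H" "U \<in> carrier ?H"
    "\<And>\<phi> x. \<phi> \<in> carrier ?M \<Longrightarrow> x \<in> X \<Longrightarrow> S \<phi> x = U \<phi> x" for S U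
    using that by (intro M.Hom_alg_eqI fun_eqI) (auto intro: M.Hom_algD)
  have T_apply: "T (Vert v) \<phi> x = (if x \<in> D v then \<phi> x else \<zero>\<^bsub>K\<^esub>)"
    "T (Edge e) \<phi> x = (if x \<in> R e then \<phi> (inv_into (D (head E e)) (f e) x) else \<zero>\<^bsub>K\<^esub>)"
    "T (Ghost e) \<phi> x = (if x \<in> D (head E e) then \<phi> (f e x) else \<zero>\<^bsub>K\<^esub>)"
    if "\<phi> \<in> carrier ?M" "x \<in> X" for \<phi> x v e
    using that by (simp_all add: T_def P_op_def S_op_def S_star_op_def)
  have TT: "(T g \<otimes>\<^bsub>?H\<^esub> T h) \<phi> x = T g (T h \<phi>) x" "T h \<phi> \<in> carrier ?M"
    if "\<phi> \<in> carrier ?M" "h \<in> lpa_gens E" for g h \<phi> x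
    using that M.Hom_algD(1)[OF T_Hom] by (simp_all add: M.Hom_alg_apply)
  note rel = T_apply TT gens f_in inv_in inv_f H.mult_closed T_Hom
  have zero_apply: "\<zero>\<^bsub>?H\<^esub> \<phi> x = \<zero>\<^bsub>K\<^esub>" if "\<phi> \<in> carrier ?M" "x \<in> X" for \<phi> x
    using that by (simp add: Hom_alg_def fun_module_def)
  \<comment> \<open>Each relation is checked at a point of \<open>X\<close>. Disjointness of the
    \<open>D v\<close> gives orthogonality of vertices and disjointness of the \<open>R e\<close>
    that of distinct edges; \<open>R_subset_D\<close> gives the two source relations, the bijections
    \<open>f e\<close> the range relations and the equal-edge case, and \<open>D_eq_Union\<close>
    the sum at a vertex.\<close>
  have "lpa_relators K E \<subseteq> a_kernel ?A ?H F.eval"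
  proof
    fix a assume "a \<in> lpa_relators K E"
    then show "a \<in> a_kernel ?A ?H F.eval"
    proof cases
      case (vertex_idem v)
      have "T (Vert v) \<otimes>\<^bsub>?H\<^esub> T (Vert v) = T (Vert v)"
        using vertex_idem by (intro T_eqI) (simp_all add: rel)
      then show ?thesis using vertex_idem
        by (auto intro!: ker_minus simp: A.mult_closed gen gens ev_mult F.eval_free_gen)
    next
      case (vertex_orth u v)
      have "T (Vert u) \<otimes>\<^bsub>?H\<^esub> T (Vert v) = \<zero>\<^bsub>?H\<^esub>"
        using vertex_orth B.D_disjoint[of u v] by (intro T_eqI) (auto simp: rel zero_apply)
      then show ?thesis using vertex_orth
        by (simp add: a_kernel_eq A.mult_closed gen gens ev_mult)
    next
      case (source_edge e)
      have "T (Vert (tail E e)) \<otimes>\<^bsub>?H\<^esub> T (Edge e) = T (Edge e)"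
        using source_edge B.R_subset_D[of e] by (intro T_eqI) (auto simp: rel)
      then show ?thesis using source_edge
        by (auto intro!: ker_minus simp: A.mult_closed gen gens ev_mult F.eval_free_gen)
    next
      case (edge_range e)
      have "T (Edge e) \<otimes>\<^bsub>?H\<^esub> T (Vert (head E e)) = T (Edge e)"
        using edge_range by (intro T_eqI) (auto simp: rel)
      then show ?thesis using edge_range
        by (auto intro!: ker_minus simp: A.mult_closed gen gens ev_mult F.eval_free_gen)
    next
      case (range_ghost e)
      have "T (Vert (head E e)) \<otimes>\<^bsub>?H\<^esub> T (Ghost e) = T (Ghost e)"
        using range_ghost by (intro T_eqI) (auto simp: rel)
      then show ?thesis using range_ghost
        by (auto intro!: ker_minus simp: A.mult_closed gen gens ev_mult F.eval_free_gen)
    next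
      case (ghost_source e)
      have "f e x \<in> D (tail E e)" if "x \<in> D (head E e)" for x
        using that ghost_source f_in(1) B.R_subset_D by blast
      then have "T (Ghost e) \<otimes>\<^bsub>?H\<^esub> T (Vert (tail E e)) = T (Ghost e)"
        using ghost_source by (intro T_eqI) (simp_all add: rel)
      then show ?thesis using ghost_source
        by (auto intro!: ker_minus simp: A.mult_closed gen gens ev_mult F.eval_free_gen)
    next
      case (ghost_edge_same e)
      have "T (Ghost e) \<otimes>\<^bsub>?H\<^esub> T (Edge e) = T (Vert (head E e))"
        using ghost_edge_same by (intro T_eqI) (auto simp: rel)
      then show ?thesis using ghost_edge_same
        by (auto intro!: ker_minus simp: A.mult_closed gen gens ev_mult F.eval_free_gen)
    next
      case (ghost_edge_diff e d)
      have "f e x \<notin> R d" if "x \<in> D (head E e)" for x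
        using that ghost_edge_diff f_in(1) B.R_disjoint[of d e] by blast
      then have "T (Ghost e) \<otimes>\<^bsub>?H\<^esub> T (Edge d) = \<zero>\<^bsub>?H\<^esub>"
        using ghost_edge_diff by (intro T_eqI) (simp_all add: rel zero_apply H.zero_closed)
      then show ?thesis using ghost_edge_diff
        by (simp add: a_kernel_eq A.mult_closed gen gens ev_mult)
    next
      case (vertex_sum v)
      let ?S = "\<lambda>e. T (Edge e) \<otimes>\<^bsub>?H\<^esub> T (Ghost e)"
      have arcs: "e \<in> arcs E" if "e \<in> out_arcs E v" for e
        using that by (simp add: out_arcs_def)
      note Dv = B.D_eq_Union[OF vertex_sum(2-4)]
      have S_closed: "?S \<in> out_arcs E v \<rightarrow> carrier ?H"
        using arcs by (auto simp: rel)
      have "T (Vert v) = (\<Oplus>\<^bsub>?H\<^esub>e\<in>out_arcs E v. ?S e)"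
      proof (rule T_eqI)
        fix \<phi> x assume \<phi>: "\<phi> \<in> carrier ?M" and x: "x \<in> X"
        \<comment> \<open>Evaluation at a fixed function and point is additive, so the sum of
          operators becomes a sum of scalars.\<close>
        have "(\<lambda>U. U \<phi> x) \<in> hom (add_monoid ?H) (add_monoid K)"
          using \<phi> x by (auto simp: hom_def Hom_alg_def fun_module_def PiE_iff)
        then have "(\<Oplus>\<^bsub>?H\<^esub>e\<in>out_arcs E v. ?S e) \<phi> x = (\<Oplus>\<^bsub>K\<^esub>e\<in>out_arcs E v. ?S e \<phi> x)"
          using vertex_sum S_closed K.abelian_group_axioms by (intro H.hom_finsum_group)
        \<comment> \<open>On \<open>R e\<close> the pullback along the inverse of \<open>f e\<close>
          is undone by the one along \<open>f e\<close>; off \<open>R e\<close> the outer operator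
          gives zero.\<close>
        also have "\<dots> = (\<Oplus>\<^bsub>K\<^esub>e\<in>out_arcs E v. if x \<in> R e then \<phi> x else \<zero>\<^bsub>K\<^esub>)"
          using \<phi> x arcs mem by (intro K.finsum_cong') (auto simp: rel)
        also have "\<dots> = (if x \<in> D v then \<phi> x else \<zero>\<^bsub>K\<^esub>)"
        proof (cases "x \<in> D v")
          case True
          then obtain d where d: "d \<in> out_arcs E v" "x \<in> R d"
            unfolding Dv by blast
          \<comment> \<open>By disjointness \<open>d\<close> is the one edge whose range set
            contains x, so membership becomes a Kronecker delta in the form that
            \<open>finsum_singleton\<close> collapses.\<close>
          then have "(\<Oplus>\<^bsub>K\<^esub>e\<in>out_arcs E v. if x \<in> R e then \<phi> x else \<zero>\<^bsub>K\<^esub>)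
            = (\<Oplus>\<^bsub>K\<^esub>e\<in>out_arcs E v. if d = e then \<phi> x else \<zero>\<^bsub>K\<^esub>)"
            using B.R_disjoint arcs mem[OF \<phi> x] by (intro K.finsum_cong') auto
          also have "\<dots> = \<phi> x"
            using K.finsum_singleton[of d "out_arcs E v" "\<lambda>_. \<phi> x"] d vertex_sum mem[OF \<phi> x] by simp
          finally show ?thesis using True by simp
        next
          case False
          then show ?thesis
            unfolding Dv by (intro trans[OF K.add.finprod_one_eqI]) auto
        qed
        finally show "T (Vert v) \<phi> x = (\<Oplus>\<^bsub>?H\<^esub>e\<in>out_arcs E v. ?S e) \<phi> x"
          using \<phi> x by (simp add: T_apply)
      qed (use vertex_sum S_closed in \<open>auto simp: rel intro!: H.finsum_closed\<close>)
      also have "\<dots> = (\<Oplus>\<^bsub>?H\<^esub>e\<in>out_arcs E v. F.eval (free_gen K (Edge e) \<otimes>\<^bsub>?A\<^esub> free_gen K (Ghost e)))"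
        using S_closed arcs by (intro H.finsum_cong') (auto simp: ev_mult gens)
      also have "\<dots> = F.eval (\<Oplus>\<^bsub>?A\<^esub>e\<in>out_arcs E v. free_gen K (Edge e) \<otimes>\<^bsub>?A\<^esub> free_gen K (Ghost e))"
        using vertex_sum arcs H.abelian_group_axioms ev_hom
        by (intro A.hom_finsum_group[symmetric]) (auto simp: A.mult_closed gen gens)
      finally show ?thesis
        using vertex_sum arcs
        by (auto intro!: ker_minus A.finsum_closed simp: A.mult_closed gen gens F.eval_free_gen)
    qed
  qed
  then have "lpa_ideal K E \<subseteq> a_kernel ?A ?H F.eval"
    unfolding lpa_ideal_def
    by (intro generated_ideal_minimal algebra_ideal_kernel A.distrib_algebra_axioms
        H.distrib_algebra_axioms F.eval_algebra_hom)
  then obtain \<pi> where \<pi>: "\<pi> \<in> algebra_hom K (leavitt_path_algebra K E) ?H"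
    "\<And>a. a \<in> carrier ?A \<Longrightarrow> \<pi> (lpa_ideal K E +>\<^bsub>?A\<^esub> a) = F.eval a"
    using quotient_algebra_hom[OF A.distrib_algebra_axioms H.distrib_algebra_axioms
        F.eval_algebra_hom, of "lpa_ideal K E"] zero_in_generated_ideal[of ?A K]
    unfolding leavitt_path_algebra_def lpa_ideal_def by blast
  have "\<pi> (lpa_elem K E g) = T g" if "g \<in> lpa_gens E" for g
    using that by (simp add: lpa_elem_def \<pi>(2) gen F.eval_free_gen)
  then show ?thesis
    using \<pi>(1) by (intro bexI[of _ \<pi>]) (auto simp: gens T_def)
qed

end
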